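(* Let $L\ge1$ and let $f:\mathbb{R}^d\to\mathbb{R}$ be (weakly) convex and $L$-smooth with a minimizer $x^*$. Let $\varepsilon>0$. Run the algorithm RHGD with stepsize $h=\frac{1}{7\sqrt L}$ and refreshment rates $\gamma_k=\frac{17}{2(k+9)h}$, from any $x_0\in\mathbb{R}^d$ (and $y_0=0$). If the number of iterations $K$ satisfies $$K\ge\sqrt{\frac{686\,L\cdot\mathbb{E}\left[\|x_0-x^*\|^2\right]}{\varepsilon}},$$ then $\mathbb{E}[f(x_K)-f(x^* )]\le\varepsilon$.
   Context: $\|\cdot\|$ is the Euclidean norm. A differentiable $f$ is (weakly) convex if $f(y)\ge f(x)+\langle\nabla f(x),y-x\rangle$ for all $x,y$, and $L$-smooth if $\|\nabla f(x)-\nabla f(y)\|\le L\|x-y\|$ for all $x,y$. Randomized Hamiltonian gradient descent (RHGD) with stepsize $h>0$ and refreshment rates $\gamma_k>0$: from $x_0\in\mathbb{R}^d$ and $y_0=0$, for $k=0,1,2,\dots$ set $x_{k+\frac12}=x_k+hy_k$; $x_{k+1}=x_{k+\frac12}-h^2\nabla f(x_{k+\frac12})$; $\tilde y_{k+1}=y_k-h\nabla f(x_{k+1})$; $y_{k+1}=\tilde y_{k+1}$ with probability $1-\min(\gamma_kh,1)$ and $y_{k+1}=0$ with probability $\min(\gamma_kh,1)$, the random choice at each iteration being independent of the past. Expectations are over these random choices (for deterministic $x_0$ the expectation of functions of $x_0$ is trivial). *)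

theory Defs
  imports "HOL-Probability.Probability"
begin

definition grad :: "(real ^ 'd \<Rightarrow> real) \<Rightarrow> real ^ 'd \<Rightarrow> real ^ 'd" where
  "grad f x = (THE D. GDERIV f x :> D)"

lemma GDERIV_grad:
  assumes "f differentiable (at x)"
  shows "GDERIV f x :> grad f x"
proof -
  from assms obtain f' where f': "(f has_derivative f') (at x)"
    by (auto simp: differentiable_def)
  then interpret f': bounded_linear f'
    by (rule has_derivative_bounded_linear)
  have "f' = (\<lambda>h. h \<bullet> adjoint f' 1)"
    using adjoint_works[OF f'.linear_axioms] by fastforce
  then have *: "GDERIV f x :> adjoint f' 1"
    using f' by (simp add: gderiv_def)
  have "D = D'" if "GDERIV f x :> D" "GDERIV f x :> D'" for D D'
  proof -
    have "(\<lambda>h. h \<bullet> D) = (\<lambda>h. h \<bullet> D')"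
      using that unfolding gderiv_def by (rule has_derivative_unique)
    then show ?thesis
      by (metis vector_eq_ldot)
  qed
  then show ?thesis
    unfolding grad_def using * by (metis theI)
qed

definition weakly_convex :: "(real ^ 'd \<Rightarrow> real) \<Rightarrow> bool" where
  "weakly_convex f \<longleftrightarrow>
     (\<forall>x. f differentiable (at x)) \<and>
     (\<forall>x y. f y \<ge> f x + grad f x \<bullet> (y - x))"

definition smooth :: "real \<Rightarrow> (real ^ 'd \<Rightarrow> real) \<Rightarrow> bool" where
  "smooth L f \<longleftrightarrow>
     (\<forall>x. f differentiable (at x)) \<and>
     (\<forall>x y. norm (grad f x - grad f y) \<le> L * norm (x - y))"

text \<open>
  One run of the algorithm for a fixed outcome of the random choices: \<open>refresh k\<close> says that
  iteration \<open>k\<close> resets the momentum. The pair is $(x_k, y_k)$.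
\<close>

primrec rhgd ::
    "(real ^ 'd \<Rightarrow> real) \<Rightarrow> real \<Rightarrow> (nat \<Rightarrow> bool) \<Rightarrow> real ^ 'd \<Rightarrow> nat \<Rightarrow> (real ^ 'd) \<times> (real ^ 'd)"
  where
  "rhgd f h refresh x0 0 = (x0, 0)"
| "rhgd f h refresh x0 (Suc k) =
     (let (x, y) = rhgd f h refresh x0 k;
          x_half = x + h *\<^sub>R y;
          x_new = x_half - h\<^sup>2 *\<^sub>R grad f x_half;
          y_tilde = y - h *\<^sub>R grad f x_new
      in (x_new, if refresh k then 0 else y_tilde))"

text \<open>
  The randomness of the algorithm: a (possibly random) starting point \<open>x0\<close>, deterministic starting
  points being the constant functions, and the events \<open>refresh k\<close> that iteration \<open>k\<close> resets the
  momentum. The past at iteration \<open>k\<close> is the sigma-algebra generated by the starting point and the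
  choices of the iterations before \<open>k\<close>; the iterates $x_0, y_0, \ldots, x_k, y_k$ are functions
  of these.
\<close>

locale rhgd_randomness = prob_space M
  for M :: "'w measure" +
  fixes x0 :: "'w \<Rightarrow> real ^ 'd"
    and h :: real
    and \<gamma> :: "nat \<Rightarrow> real"
    and refresh :: "nat \<Rightarrow> 'w set"
  assumes x0_measurable: "random_variable borel x0"
    and refresh_event: "refresh k \<in> events"
    and prob_refresh: "prob (refresh k) = min (\<gamma> k * h) 1"
    and refresh_indep_past:
      "indep_set {refresh k}
         (sigma_sets (space M)
           ({x0 -` S \<inter> space M | S. S \<in> sets borel} \<union> refresh ` {..<k}))"

end

theory Submission
  imports Defs
begin

text \<open>
  Rescale to \<open>v = h y\<close> and \<open>F = h\<^sup>2 (f - f xstar)\<close>. The gradient of \<open>F\<close> is Lipschitz with constant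
  \<open>L h\<^sup>2 = 1 / 49\<close>, and iteration \<open>k\<close> keeps the momentum with probability
  \<open>(2 k + 1) / (2 (k + 9))\<close>. The proof rests on the potential
  \[ (2k+1)(k+11)\,F(x_k) + 11\|x_k-x^*\|^2 + \|2(x_k-x^*)+(k+8)v_k\|^2, \]
  whose expectation never increases (\<open>expected_potential_decrease\<close>).

  The shape of this potential comes from the underlying dynamics \<open>x' = v\<close>, \<open>v' = - grad F x\<close>:
  as in accelerated methods, one tracks a quadratic form in the distance to the minimizer and the
  momentum, together with a quadratically growing multiple of \<open>F\<close>. In the quadratic part the inner
  product of \<open>x - xstar\<close> with \<open>v\<close> has coefficient \<open>4 (k + 8)\<close>. Moving by \<open>v\<close> increases this
  coefficient, since \<open>15 \<parallel>x - xstar\<parallel>\<^sup>2\<close> changes to first order by \<open>30\<close> times the product, while a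
  refreshment removes the product. The two effects balance exactly, because
  \<open>4 (k + 9)\<close> times the probability of keeping the momentum is \<open>4 (k + 8) - 30\<close>. The remaining
  inner products involve gradients and are absorbed by convexity, applied to pairs among \<open>x_k\<close>,
  \<open>x_{k+1/2}\<close>, \<open>x_{k+1}\<close> and the minimizer. Within an iteration, the Lipschitz property makes the
  two gradients evaluated there nearly equal. All of this is one inequality about vectors
  of an inner product space (\<open>potential_decrease_abstract\<close>).

  The step inequality holds for each fixed state, on average over a single refreshment. Since the
  state is a function of the past and the refreshment is independent of the past, it integrates to
  an inequality between expectations. Expectations are taken of nonnegative functions with values
  in the extended reals, so integrability of the iterates comes out at the end instead of being
  carried along.

  Initially the momentum vanishes and the potential is at most \<open>16 \<parallel>x\<^sub>0 - xstar\<parallel>\<^sup>2\<close>. Dropping the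
  quadratic part after \<open>K\<close> iterations gives
  \[ (2K+1)(K+11)\,h^2\,\mathbf{E}[f(x_K)-f(x^*)] \le 16\,\mathbf{E}\|x_0-x^*\|^2, \]
  and with \<open>h\<^sup>2 = 1 / (49 L)\<close> the required number of iterations follows from
  \<open>16 \<cdot> 49 = 784 \<le> 2 \<cdot> 686\<close>.
\<close>

section \<open>Convex smooth functions\<close>

lemma weakly_convexD:
  assumes "weakly_convex f"
  shows "f x + grad f x \<bullet> (y - x) \<le> f y"
  using assms by (auto simp: weakly_convex_def)

lemma smoothD:
  assumes "smooth L f"
  shows "norm (grad f x - grad f y) \<le> L * norm (x - y)"
  using assms by (auto simp: smooth_def)

lemma grad_minimizer_eq_0:
  assumes "f differentiable (at xstar)" and "\<And>x. f xstar \<le> f x"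
  shows "grad f xstar = 0"
proof -
  have "(f has_derivative (\<lambda>d. d \<bullet> grad f xstar)) (at xstar)"
    using GDERIV_grad[OF assms(1)] by (simp add: gderiv_def)
  then have "(\<lambda>d. d \<bullet> grad f xstar) = (\<lambda>d. 0)"
    using assms(2) by (intro differential_zero_maxmin[of xstar UNIV f]) auto
  then show ?thesis
    by (metis inner_eq_zero_iff)
qed

lemma continuous_on_smooth:
  assumes "smooth L f"
  shows "continuous_on S f"
  using assms
  by (auto simp: smooth_def intro!: continuous_at_imp_continuous_on differentiable_imp_continuous_within)

lemma continuous_on_grad:
  assumes "smooth L f"
  shows "continuous_on S (grad f)"
proof -
  have "\<bar>L\<bar>-lipschitz_on S (grad f)"
  proof (rule lipschitz_onI)
    fix x y
    show "dist (grad f x) (grad f y) \<le> \<bar>L\<bar> * dist x y"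
      using smoothD[OF assms, of x y] mult_right_mono[OF abs_ge_self[of L] norm_ge_zero[of "x - y"]]
      by (simp add: dist_norm)
  qed simp
  then show ?thesis
    by (rule lipschitz_on_continuous_on)
qed

section \<open>Decrease of the potential in one iteration\<close>

text \<open>
  One iteration as a map of the state, with the outcome \<open>r\<close> of the refreshment as a parameter, so
  that both outcomes can be compared from the same state.
\<close>

definition step :: "(real ^ 'd \<Rightarrow> real) \<Rightarrow> real \<Rightarrow> bool \<Rightarrow>
    (real ^ 'd) \<times> (real ^ 'd) \<Rightarrow> (real ^ 'd) \<times> (real ^ 'd)" where
  "step f h r s =
     (let z = fst s + h *\<^sub>R snd s;
          x = z - h\<^sup>2 *\<^sub>R grad f z
      in (x, if r then 0 else snd s - h *\<^sub>R grad f x))"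

lemma rhgd_Suc_eq_step:
  "rhgd f h refresh x0 (Suc k) = step f h (refresh k) (rhgd f h refresh x0 k)"
  by (simp add: step_def Let_def split: prod.split)

lemma continuous_on_step:
  fixes f :: "real ^ 'd \<Rightarrow> real"
  assumes "smooth L f"
  shows "continuous_on UNIV (step f h r)"
proof -
  have *: "continuous_on UNIV (\<lambda>s. grad f (u s))"
    if "continuous_on UNIV u" for u :: "(real ^ 'd) \<times> (real ^ 'd) \<Rightarrow> real ^ 'd"
    using continuous_on_compose2[OF continuous_on_grad[OF assms, of UNIV] that] by simp
  show ?thesis
    unfolding step_def Let_def by (cases r) (auto intro!: continuous_intros *)
qed

text \<open>
  The quadratic part equals
  \<open>15 \<parallel>x - xstar\<parallel>\<^sup>2 + 4 (k + 8) (x - xstar) \<bullet> v + (k + 8)\<^sup>2 \<parallel>v\<parallel>\<^sup>2\<close> for the scaled momentum \<open>v = h y\<close>;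
  the form as a sum of squares shows that it is nonnegative.
\<close>

definition potential :: "(real ^ 'd \<Rightarrow> real) \<Rightarrow> real \<Rightarrow> real ^ 'd \<Rightarrow> nat \<Rightarrow>
    (real ^ 'd) \<times> (real ^ 'd) \<Rightarrow> real" where
  "potential f h xstar k s =
     (2 * real k + 1) * (real k + 11) * (h\<^sup>2 * (f (fst s) - f xstar))
     + 11 * (norm (fst s - xstar))\<^sup>2
     + (norm (2 *\<^sub>R (fst s - xstar) + (real k + 8) *\<^sub>R (h *\<^sub>R snd s)))\<^sup>2"

lemma potential_nonneg:
  assumes "\<And>x. f xstar \<le> f x"
  shows "0 \<le> potential f h xstar k s"
  using assms by (auto simp: potential_def intro!: add_nonneg_nonneg mult_nonneg_nonneg)

lemma continuous_on_potential:
  fixes f :: "real ^ 'd \<Rightarrow> real"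
  assumes "smooth L f"
  shows "continuous_on UNIV (potential f h xstar k)"
proof -
  have "continuous_on UNIV (\<lambda>s :: (real ^ 'd) \<times> (real ^ 'd). f (fst s))"
    by (rule continuous_on_compose2[OF continuous_on_smooth[OF assms, of UNIV]])
      (auto intro: continuous_intros)
  then show ?thesis
    unfolding potential_def by (intro continuous_intros) auto
qed

text \<open>
  The step inequality, stripped of the algorithm. The vector \<open>x\<close> is the position relative to the
  minimizer, \<open>v\<close> the scaled momentum, and \<open>g\<close>, \<open>g'\<close> are the scaled gradients at the points
  \<open>x + v\<close> and \<open>x + v - g\<close>. The numbers \<open>Fx\<close>, \<open>Fz\<close>, \<open>Fp\<close> are the scaled gaps at \<open>x\<close>, \<open>x + v\<close> and
  \<open>x + v - g\<close>. The inequalities \<open>min_p\<close> to \<open>z_p\<close> are instances of convexity.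

  The proof writes the decrease as a combination of the hypotheses with nonnegative weights plus
  squares. The weights are forced: \<open>2 (2 n + 1)\<close> on \<open>min_p\<close> and \<open>30\<close> on \<open>min_z\<close> cancel the inner
  products of \<open>x\<close> with \<open>g'\<close> and \<open>g\<close>; those on \<open>x_z\<close> and \<open>x_p\<close> cancel the inner products of \<open>v\<close>
  with \<open>g\<close> and \<open>g'\<close>, and their sum \<open>(2 n + 1) (n + 11)\<close> is what dictates the coefficient of \<open>f\<close>
  in the potential; finally the weight on \<open>z_p\<close> cancels \<open>Fz\<close>. This last hypothesis
  contributes the inner product of \<open>g\<close> with \<open>g'\<close>, which is at least half of \<open>\<parallel>g\<parallel>\<^sup>2\<close> and pays for
  the error \<open>15 \<parallel>g\<parallel>\<^sup>2\<close> of the gradient step.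
\<close>

lemma potential_decrease_abstract:
  fixes x v g g' :: "'a :: real_inner" and Fx Fz Fp n :: real
  assumes n: "0 \<le> n"
    and Fp: "0 \<le> Fp"
    and min_p: "Fp \<le> (x + v - g) \<bullet> g'"
    and min_z: "Fz \<le> (x + v) \<bullet> g"
    and x_z: "Fz - v \<bullet> g \<le> Fx"
    and x_p: "Fp + (g - v) \<bullet> g' \<le> Fx"
    and z_p: "Fp + g \<bullet> g' \<le> Fz"
    and close: "norm (g - g') \<le> norm g / 2"
  defines "p \<equiv> 17 / (2 * (n + 9))"
  shows "(2 * n + 3) * (n + 12) * Fp + 11 * (norm (x + v - g))\<^sup>2
           + (1 - p) * (norm (2 *\<^sub>R (x + v - g) + (n + 9) *\<^sub>R (v - g')))\<^sup>2
           + p * (norm (2 *\<^sub>R (x + v - g)))\<^sup>2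
         \<le> (2 * n + 1) * (n + 11) * Fx + 11 * (norm x)\<^sup>2
           + (norm (2 *\<^sub>R x + (n + 8) *\<^sub>R v))\<^sup>2"
    (is "?new \<le> ?old")
proof -
  \<comment> \<open>The factor \<open>n + 9\<close> in front of the new momentum cancels the denominator of the keeping probability.\<close>
  have keep: "(1 - p) * (n + 9) = (2 * n + 1) / 2"
    using n by (simp add: p_def field_simps)
  have refresh_average: "(1 - p) * (A + (n + 9) * B) + p * A = A + (2 * n + 1) / 2 * B" for A B
    unfolding keep[symmetric] by (simp add: algebra_simps)
  have "(norm (2 *\<^sub>R (x + v - g) + (n + 9) *\<^sub>R (v - g')))\<^sup>2
      = (norm (2 *\<^sub>R (x + v - g)))\<^sup>2
        + (n + 9) * (4 * ((x + v - g) \<bullet> (v - g')) + (n + 9) * (norm (v - g'))\<^sup>2)"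
    unfolding power2_norm_eq_inner
    by (simp add: inner_simps inner_commute algebra_simps)
  then have new: "?new = (2 * n + 3) * (n + 12) * Fp + 15 * (norm (x + v - g))\<^sup>2
      + (2 * n + 1) / 2 * (4 * ((x + v - g) \<bullet> (v - g')) + (n + 9) * (norm (v - g'))\<^sup>2)"
    using refresh_average[of "(norm (2 *\<^sub>R (x + v - g)))\<^sup>2"
        "4 * ((x + v - g) \<bullet> (v - g')) + (n + 9) * (norm (v - g'))\<^sup>2"]
    by (simp add: power_mult_distrib)
  have norm_diff: "norm (g - g') \<le> norm g"
    using close norm_ge_zero[of g] by linarith
  have "g \<bullet> (g - g') \<le> norm g * (norm g / 2)"
    using norm_cauchy_schwarz[of g "g - g'"] mult_left_mono[OF close norm_ge_zero[of g]] by linarith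
  then have corr: "(norm g)\<^sup>2 / 2 \<le> g \<bullet> g'"
    by (simp add: inner_diff_right power2_norm_eq_inner[symmetric] power2_eq_square)
  have "?old - ?new =
        2 * (2 * n + 1) * ((x + v - g) \<bullet> g' - Fp)
      + 30 * ((x + v) \<bullet> g - Fz)
      + 2 * (2 * n + 1) * (Fx - (Fz - v \<bullet> g))
      + (2 * n + 1) * (n + 9) * (Fx - (Fp + (g - v) \<bullet> g'))
      + (4 * n + 32) * (Fz - (Fp + g \<bullet> g'))
      + 7 * Fp
      + (5 * n + 85) / 2 * (norm v)\<^sup>2
      + (2 * n + 1) * (n + 9) / 2 * ((norm g)\<^sup>2 - (norm (g - g'))\<^sup>2)
      + (4 * n + 32) * (g \<bullet> g' - (norm g)\<^sup>2 / 2)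
      + (2 * n + 1) * (norm g)\<^sup>2"
    unfolding new unfolding power2_norm_eq_inner
    by (simp add: inner_simps inner_commute field_simps)
  also have "\<dots> \<ge> 0"
    using assms(1-7) corr norm_diff
    by (intro add_nonneg_nonneg mult_nonneg_nonneg) simp_all
  finally show ?thesis by simp
qed

text \<open>
  Averaging over the two outcomes is indispensable: if the momentum is kept, the potential can
  increase, for instance when \<open>f\<close> is constant and the momentum points away from \<open>xstar\<close>.
\<close>

lemma potential_decrease:
  fixes f :: "real ^ 'd \<Rightarrow> real"
  assumes cvx: "weakly_convex f" and smooth: "smooth L f" and min: "\<And>x. f xstar \<le> f x"
    and Lh: "L * h\<^sup>2 \<le> 1 / 2"
  defines "p \<equiv> \<lambda>k. 17 / (2 * (real k + 9))"
  shows "(1 - p k) * potential f h xstar (Suc k) (step f h False s)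
         + p k * potential f h xstar (Suc k) (step f h True s)
         \<le> potential f h xstar k s"
proof -
  obtain x y where s: "s = (x, y)" by fastforce
  define v where "v = h *\<^sub>R y"
  define g where "g = h\<^sup>2 *\<^sub>R grad f (x + v)"
  define g' where "g' = h\<^sup>2 *\<^sub>R grad f (x + v - g)"
  define F where "F = (\<lambda>u. h\<^sup>2 * (f u - f xstar))"
  have F_eq: "h\<^sup>2 * (f u - f xstar) = F u" for u
    by (simp add: F_def)
  have cvxF: "F a + (h\<^sup>2 *\<^sub>R grad f a) \<bullet> (b - a) \<le> F b" for a b
    using mult_left_mono[OF weakly_convexD[OF cvx, of a b], of "h\<^sup>2"]
    by (simp add: F_def algebra_simps)
  have "norm (g - g') = h\<^sup>2 * norm (grad f (x + v) - grad f (x + v - g))"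
    by (simp add: g_def g'_def flip: scaleR_diff_right)
  also have "\<dots> \<le> h\<^sup>2 * (L * norm g)"
    using smoothD[OF smooth, of "x + v" "x + v - g"] by (intro mult_left_mono) auto
  also have "\<dots> \<le> norm g / 2"
    using mult_right_mono[OF Lh norm_ge_zero[of g]] by (simp add: mult_ac)
  finally have close: "norm (g - g') \<le> norm g / 2" .
  have ineqs: "F (x + v - g) \<le> (x - xstar + v - g) \<bullet> g'" "F (x + v) \<le> (x - xstar + v) \<bullet> g"
    "F (x + v) - v \<bullet> g \<le> F x" "F (x + v - g) + (g - v) \<bullet> g' \<le> F x"
    "F (x + v - g) + g \<bullet> g' \<le> F (x + v)"
    using cvxF[of "x + v - g" xstar] cvxF[of "x + v" xstar] cvxF[of "x + v" x]
      cvxF[of "x + v - g" x] cvxF[of "x + v - g" "x + v"]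
    unfolding g_def[symmetric] g'_def[symmetric]
    by (simp_all add: F_def inner_simps inner_commute algebra_simps)
  have Fnonneg: "0 \<le> F (x + v - g)"
    using min by (simp add: F_def)
  have stepF: "step f h False s = (x + v - g, y - h *\<^sub>R grad f (x + v - g))"
    and stepT: "step f h True s = (x + v - g, 0)"
    by (simp_all add: s step_def Let_def v_def g_def)
  have mom: "h *\<^sub>R (y - h *\<^sub>R grad f (x + v - g)) = v - g'"
    by (simp add: v_def g'_def scaleR_diff_right power2_eq_square)
  have pos: "x + v - g - xstar = x - xstar + v - g"
    by simp
  have "(1 - p k) * (a + b + c) + p k * (a + b + d) = a + b + (1 - p k) * c + p k * d" for a b c d
    by (simp add: algebra_simps)
  then have "(1 - p k) * potential f h xstar (Suc k) (step f h False s)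
         + p k * potential f h xstar (Suc k) (step f h True s)
       = (2 * real k + 3) * (real k + 12) * F (x + v - g) + 11 * (norm (x - xstar + v - g))\<^sup>2
           + (1 - p k) * (norm (2 *\<^sub>R (x - xstar + v - g) + (real k + 9) *\<^sub>R (v - g')))\<^sup>2
           + p k * (norm (2 *\<^sub>R (x - xstar + v - g)))\<^sup>2"
    unfolding stepF stepT potential_def fst_conv snd_conv mom pos F_eq
    by (simp add: algebra_simps)
  also have "\<dots> \<le> (2 * real k + 1) * (real k + 11) * F x + 11 * (norm (x - xstar))\<^sup>2
           + (norm (2 *\<^sub>R (x - xstar) + (real k + 8) *\<^sub>R v))\<^sup>2"
    unfolding p_def
    by (rule potential_decrease_abstract[where Fz = "F (x + v)"]) (use ineqs close Fnonneg in auto)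
  also have "\<dots> = potential f h xstar k s"
    by (simp add: s potential_def F_def v_def)
  finally show ?thesis .
qed

text \<open>
  At \<open>k = 0\<close> the potential is \<open>11 h\<^sup>2 (f x - f xstar) + 15 \<parallel>x - xstar\<parallel>\<^sup>2\<close>. The gradient vanishes at the
  minimizer, so convexity and smoothness bound the gap by \<open>L \<parallel>x - xstar\<parallel>\<^sup>2\<close>, and the first term is
  at most one more square.
\<close>

lemma potential_initial_le:
  fixes f :: "real ^ 'd \<Rightarrow> real"
  assumes cvx: "weakly_convex f" and smooth: "smooth L f" and min: "\<And>x. f xstar \<le> f x"
    and Lh: "L * h\<^sup>2 \<le> 1 / 11"
  shows "potential f h xstar 0 (x, 0) \<le> 16 * (norm (x - xstar))\<^sup>2"
proof -
  have "grad f xstar = 0"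
    using smooth min by (intro grad_minimizer_eq_0) (auto simp: smooth_def)
  then have "norm (grad f x) \<le> L * norm (x - xstar)"
    using smoothD[OF smooth, of x xstar] by simp
  then have "grad f x \<bullet> (x - xstar) \<le> L * norm (x - xstar) * norm (x - xstar)"
    by (intro order_trans[OF norm_cauchy_schwarz] mult_right_mono) auto
  moreover have "f x - f xstar \<le> grad f x \<bullet> (x - xstar)"
    using weakly_convexD[OF cvx, of x xstar] by (simp add: inner_diff_right)
  ultimately have "h\<^sup>2 * (f x - f xstar) \<le> h\<^sup>2 * (L * (norm (x - xstar))\<^sup>2)"
    by (intro mult_left_mono) (auto simp: power2_eq_square mult_ac)
  also have "\<dots> \<le> (norm (x - xstar))\<^sup>2 / 11"
    using mult_right_mono[OF Lh zero_le_power2[of "norm (x - xstar)"]] by (simp add: mult_ac)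
  finally show ?thesis
    by (simp add: potential_def power_mult_distrib)
qed

section \<open>Averaging over the refreshments\<close>

text \<open>
  Independence of \<open>E\<close> from the sub-sigma-algebra says that, restricted to it, the measure with
  density \<open>indicator E\<close> is the original measure scaled by the probability of \<open>E\<close>. Integrating
  against this one measure identity covers all measurable functions at once, including those of
  infinite expectation.
\<close>

lemma (in prob_space) nn_integral_indep_event:
  assumes sub: "subalgebra M N" and E: "E \<in> events"
    and indep: "\<And>X. X \<in> sets N \<Longrightarrow> prob (E \<inter> X) = prob E * prob X"
    and A: "A \<in> borel_measurable N"
  shows "(\<integral>\<^sup>+\<omega>. indicator E \<omega> * A \<omega> \<partial>M) = ennreal (prob E) * (\<integral>\<^sup>+\<omega>. A \<omega> \<partial>M)"
proof -
  let ?D = "density M (indicator E)"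
  have subD: "subalgebra ?D N"
    using sub by (simp add: subalgebra_def)
  have ind: "(indicator E :: _ \<Rightarrow> ennreal) \<in> borel_measurable M"
    using E by simp
  have "restr_to_subalg ?D N
      = scale_measure (ennreal (prob E)) (restr_to_subalg M N)"
  proof (rule measure_eqI)
    show "sets (restr_to_subalg ?D N)
        = sets (scale_measure (ennreal (prob E)) (restr_to_subalg M N))"
      by (simp add: sets_restr_to_subalg[OF subD] sets_restr_to_subalg[OF sub])
    fix X assume "X \<in> sets (restr_to_subalg ?D N)"
    then have X: "X \<in> sets N"
      by (simp add: sets_restr_to_subalg[OF subD])
    then have XM: "X \<in> events"
      using sub by (auto simp: subalgebra_def)
    have "prob (E \<inter> X) = prob E * prob X"
      using indep[OF X] .
    then have "emeasure M (E \<inter> X) = ennreal (prob E) * emeasure M X"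
      by (simp add: emeasure_eq_measure ennreal_mult)
    moreover have "emeasure ?D X = emeasure M (E \<inter> X)"
      using ind XM E by (simp add: emeasure_density indicator_inter_arith[symmetric])
    ultimately show "emeasure (restr_to_subalg ?D N) X
        = emeasure (scale_measure (ennreal (prob E)) (restr_to_subalg M N)) X"
      using X by (simp add: emeasure_restr_to_subalg[OF subD] emeasure_restr_to_subalg[OF sub])
  qed
  then have "(\<integral>\<^sup>+\<omega>. A \<omega> \<partial>restr_to_subalg ?D N)
      = (\<integral>\<^sup>+\<omega>. A \<omega> \<partial>scale_measure (ennreal (prob E)) (restr_to_subalg M N))"
    by simp
  moreover have "A \<in> borel_measurable M"
    by (rule measurable_from_subalg[OF sub A])
  ultimately show ?thesis
    using A ind
    by (simp add: nn_integral_subalgebra2[OF subD] nn_integral_subalgebra2[OF sub]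
        nn_integral_scale_measure measurable_in_subalg[OF sub]
        nn_integral_density)
qed

text \<open>
  The sigma-algebra of the past as a measure space, so that measurability of the iterates can be
  expressed.
\<close>

definition (in rhgd_randomness) past :: "nat \<Rightarrow> 'w measure" where
  "past k = sigma (space M) ({x0 -` S \<inter> space M | S. S \<in> sets borel} \<union> refresh ` {..<k})"

context rhgd_randomness
begin

lemma generators_in_events:
  "{x0 -` S \<inter> space M | S. S \<in> sets borel} \<union> refresh ` {..<k} \<subseteq> events"
  using x0_measurable refresh_event by (auto intro: measurable_sets)

lemma space_past [simp]: "space (past k) = space M"
  unfolding past_def
  by (rule space_measure_of[OF order_trans[OF generators_in_events sets.space_closed]])

lemma sets_past:
  "sets (past k) =
     sigma_sets (space M) ({x0 -` S \<inter> space M | S. S \<in> sets borel} \<union> refresh ` {..<k})"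
  unfolding past_def
  by (rule sets_measure_of[OF order_trans[OF generators_in_events sets.space_closed]])

lemma subalgebra_past: "subalgebra M (past k)"
  unfolding subalgebra_def sets_past
  using sets.sigma_sets_subset[OF generators_in_events] by simp

lemma subalgebra_past_Suc: "subalgebra (past (Suc k)) (past k)"
  unfolding subalgebra_def sets_past by (auto intro!: sigma_sets_mono' simp: lessThan_Suc)

lemma x0_past: "x0 \<in> borel_measurable (past k)"
  by (rule measurableI) (auto simp: sets_past intro: sigma_sets.Basic)

lemma refresh_past_Suc: "refresh k \<in> sets (past (Suc k))"
  by (auto simp: sets_past intro: sigma_sets.Basic)

lemma rhgd_past:
  assumes "smooth L f"
  shows "(\<lambda>\<omega>. rhgd f h (\<lambda>k. \<omega> \<in> refresh k) (x0 \<omega>) k) \<in> borel_measurable (past k)"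
proof (induction k)
  case 0
  have "continuous_on UNIV (\<lambda>x. (x, 0 :: real ^ 'd) :: (real ^ 'd) \<times> (real ^ 'd))"
    by (intro continuous_intros)
  from measurable_compose[OF x0_past borel_measurable_continuous_onI[OF this]] show ?case
    by simp
next
  case (Suc k)
  let ?s = "\<lambda>\<omega>. rhgd f h (\<lambda>k. \<omega> \<in> refresh k) (x0 \<omega>) k"
  have s: "?s \<in> borel_measurable (past (Suc k))"
    by (rule measurable_from_subalg[OF subalgebra_past_Suc Suc.IH])
  have "(\<lambda>\<omega>. step f h r (?s \<omega>)) \<in> borel_measurable (past (Suc k))" for r
    by (rule measurable_compose[OF s borel_measurable_continuous_onI[OF continuous_on_step[OF assms]]])
  then have "(\<lambda>\<omega>. if \<omega> \<in> refresh k then step f h True (?s \<omega>) else step f h False (?s \<omega>))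
      \<in> borel_measurable (past (Suc k))"
    using sets.Int[OF sets.top refresh_past_Suc] by (intro measurable_If) (auto simp: Int_def)
  also have "(\<lambda>\<omega>. if \<omega> \<in> refresh k then step f h True (?s \<omega>) else step f h False (?s \<omega>))
      = (\<lambda>\<omega>. rhgd f h (\<lambda>k. \<omega> \<in> refresh k) (x0 \<omega>) (Suc k))"
    unfolding rhgd_Suc_eq_step by auto
  finally show ?case .
qed

lemma prob_refresh_Int_past:
  assumes "X \<in> sets (past k)"
  shows "prob (refresh k \<inter> X) = prob (refresh k) * prob X"
  using assms indep_setD[OF refresh_indep_past] by (simp add: sets_past)

text \<open>
  If both branches are determined by the past, the indicator of the refreshment may be replaced by
  its probability. The keeping branch uses that the complement of the refreshment is independent
  of the past as well.
\<close>

lemma nn_integral_refresh_branch: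
  fixes A B :: "'w \<Rightarrow> real"
  assumes A: "A \<in> borel_measurable (past k)" and B: "B \<in> borel_measurable (past k)"
    and A0: "\<And>\<omega>. 0 \<le> A \<omega>" and B0: "\<And>\<omega>. 0 \<le> B \<omega>"
  defines "p \<equiv> prob (refresh k)"
  shows "(\<integral>\<^sup>+\<omega>. ennreal (if \<omega> \<in> refresh k then A \<omega> else B \<omega>) \<partial>M)
       = (\<integral>\<^sup>+\<omega>. ennreal ((1 - p) * B \<omega> + p * A \<omega>) \<partial>M)"
proof -
  let ?N = "space M - refresh k"
  have N: "?N \<in> events"
    using refresh_event by auto
  have probN: "prob ?N = 1 - p"
    using prob_compl[OF refresh_event] by (simp add: p_def)
  have indepN: "prob (?N \<inter> X) = prob ?N * prob X" if "X \<in> sets (past k)" for X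
  proof -
    have X: "X \<in> events"
      using that subalgebra_past by (auto simp: subalgebra_def)
    then have "?N \<inter> X = X - refresh k \<inter> X"
      using sets.sets_into_space by auto
    then have "prob (?N \<inter> X) = prob X - prob (refresh k \<inter> X)"
      using X refresh_event[of k] by (auto intro!: finite_measure_Diff)
    then show ?thesis
      using prob_refresh_Int_past[OF that] by (simp add: probN p_def algebra_simps)
  qed
  have p: "0 \<le> p" "p \<le> 1"
    by (simp_all add: p_def)
  have AM: "A \<in> borel_measurable M" and BM: "B \<in> borel_measurable M"
    using A B measurable_from_subalg[OF subalgebra_past] by auto
  note [measurable] = refresh_event N AM BM
  have "(\<integral>\<^sup>+\<omega>. ennreal (if \<omega> \<in> refresh k then A \<omega> else B \<omega>) \<partial>M)
      = (\<integral>\<^sup>+\<omega>. indicator (refresh k) \<omega> * ennreal (A \<omega>) + indicator ?N \<omega> * ennreal (B \<omega>) \<partial>M)"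
    by (intro nn_integral_cong) (auto simp: indicator_def)
  also have "\<dots> = (\<integral>\<^sup>+\<omega>. indicator (refresh k) \<omega> * ennreal (A \<omega>) \<partial>M)
      + (\<integral>\<^sup>+\<omega>. indicator ?N \<omega> * ennreal (B \<omega>) \<partial>M)"
    by (intro nn_integral_add) auto
  also have "\<dots> = ennreal p * (\<integral>\<^sup>+\<omega>. ennreal (A \<omega>) \<partial>M) + ennreal (1 - p) * (\<integral>\<^sup>+\<omega>. ennreal (B \<omega>) \<partial>M)"
    using A B nn_integral_indep_event[OF subalgebra_past refresh_event prob_refresh_Int_past]
      nn_integral_indep_event[OF subalgebra_past N indepN]
    by (simp add: probN p_def)
  also have "\<dots> = (\<integral>\<^sup>+\<omega>. ennreal p * ennreal (A \<omega>) + ennreal (1 - p) * ennreal (B \<omega>) \<partial>M)"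
    by (simp add: nn_integral_add nn_integral_cmult)
  also have "\<dots> = (\<integral>\<^sup>+\<omega>. ennreal ((1 - p) * B \<omega> + p * A \<omega>) \<partial>M)"
    using p A0 B0 by (intro nn_integral_cong) (simp add: ennreal_mult ennreal_plus add.commute)
  finally show ?thesis .
qed

lemma expected_potential_decrease:
  fixes f :: "real ^ 'd \<Rightarrow> real"
  assumes cvx: "weakly_convex f" and smooth: "smooth L f" and min: "\<And>x. f xstar \<le> f x"
    and Lh: "L * h\<^sup>2 \<le> 1 / 2"
    and rate: "prob (refresh k) = 17 / (2 * (real k + 9))"
  shows "(\<integral>\<^sup>+\<omega>. potential f h xstar (Suc k) (rhgd f h (\<lambda>k. \<omega> \<in> refresh k) (x0 \<omega>) (Suc k)) \<partial>M)
       \<le> (\<integral>\<^sup>+\<omega>. potential f h xstar k (rhgd f h (\<lambda>k. \<omega> \<in> refresh k) (x0 \<omega>) k) \<partial>M)"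
proof -
  let ?s = "\<lambda>\<omega>. rhgd f h (\<lambda>k. \<omega> \<in> refresh k) (x0 \<omega>) k"
  let ?V = "\<lambda>r \<omega>. potential f h xstar (Suc k) (step f h r (?s \<omega>))"
  have V: "?V r \<in> borel_measurable (past k)" for r
    by (rule measurable_compose[OF measurable_compose[OF rhgd_past[OF smooth]]])
      (rule borel_measurable_continuous_onI continuous_on_step[OF smooth]
        continuous_on_potential[OF smooth])+
  have "(\<integral>\<^sup>+\<omega>. potential f h xstar (Suc k) (rhgd f h (\<lambda>k. \<omega> \<in> refresh k) (x0 \<omega>) (Suc k)) \<partial>M)
      = (\<integral>\<^sup>+\<omega>. ennreal (if \<omega> \<in> refresh k then ?V True \<omega> else ?V False \<omega>) \<partial>M)"
    unfolding rhgd_Suc_eq_step by (intro nn_integral_cong) auto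
  also have "\<dots> = (\<integral>\<^sup>+\<omega>. ennreal ((1 - prob (refresh k)) * ?V False \<omega> + prob (refresh k) * ?V True \<omega>) \<partial>M)"
    by (intro nn_integral_refresh_branch V potential_nonneg min)
  also have "\<dots> \<le> (\<integral>\<^sup>+\<omega>. potential f h xstar k (?s \<omega>) \<partial>M)"
    unfolding rate by (intro nn_integral_mono ennreal_leI potential_decrease[OF cvx smooth min Lh])
  finally show ?thesis .
qed

lemma expected_potential_le:
  fixes f :: "real ^ 'd \<Rightarrow> real"
  assumes cvx: "weakly_convex f" and smooth: "smooth L f" and min: "\<And>x. f xstar \<le> f x"
    and Lh: "L * h\<^sup>2 \<le> 1 / 11"
    and rate: "\<And>k. prob (refresh k) = 17 / (2 * (real k + 9))"
    and x0_sq: "integrable M (\<lambda>\<omega>. (norm (x0 \<omega> - xstar))\<^sup>2)"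
  shows "(\<integral>\<^sup>+\<omega>. potential f h xstar k (rhgd f h (\<lambda>k. \<omega> \<in> refresh k) (x0 \<omega>) k) \<partial>M)
       \<le> ennreal (16 * (\<integral>\<omega>. (norm (x0 \<omega> - xstar))\<^sup>2 \<partial>M))"
proof (induction k)
  case 0
  have "(\<integral>\<^sup>+\<omega>. potential f h xstar 0 (rhgd f h (\<lambda>k. \<omega> \<in> refresh k) (x0 \<omega>) 0) \<partial>M)
      \<le> (\<integral>\<^sup>+\<omega>. ennreal (16 * (norm (x0 \<omega> - xstar))\<^sup>2) \<partial>M)"
    using potential_initial_le[OF cvx smooth min Lh] by (intro nn_integral_mono ennreal_leI) simp
  also have "\<dots> = ennreal (\<integral>\<omega>. 16 * (norm (x0 \<omega> - xstar))\<^sup>2 \<partial>M)"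
    using x0_sq by (intro nn_integral_eq_integral) auto
  finally show ?case by simp
next
  case (Suc k)
  have "L * h\<^sup>2 \<le> 1 / 2"
    using Lh by simp
  from order_trans[OF expected_potential_decrease[OF cvx smooth min this rate] Suc.IH]
  show ?case .
qed

lemma expected_gap_le:
  fixes f :: "real ^ 'd \<Rightarrow> real"
  assumes cvx: "weakly_convex f" and smooth: "smooth L f" and min: "\<And>x. f xstar \<le> f x"
    and h: "h \<noteq> 0" and Lh: "L * h\<^sup>2 \<le> 1 / 11"
    and rate: "\<And>k. prob (refresh k) = 17 / (2 * (real k + 9))"
    and x0_sq: "integrable M (\<lambda>\<omega>. (norm (x0 \<omega> - xstar))\<^sup>2)"
  defines "gap \<equiv> \<lambda>k \<omega>. f (fst (rhgd f h (\<lambda>k. \<omega> \<in> refresh k) (x0 \<omega>) k)) - f xstar"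
  shows "integrable M (gap k)"
    and "(2 * real k + 1) * (real k + 11) * h\<^sup>2 * (\<integral>\<omega>. gap k \<omega> \<partial>M)
       \<le> 16 * (\<integral>\<omega>. (norm (x0 \<omega> - xstar))\<^sup>2 \<partial>M)"
proof -
  let ?s = "\<lambda>\<omega>. rhgd f h (\<lambda>k. \<omega> \<in> refresh k) (x0 \<omega>) k"
  define c where "c = (2 * real k + 1) * (real k + 11) * h\<^sup>2"
  have c: "c > 0"
    using h by (simp add: c_def)
  have "?s \<in> borel_measurable M"
    by (rule measurable_from_subalg[OF subalgebra_past rhgd_past[OF smooth]])
  then have "(\<lambda>\<omega>. fst (?s \<omega>)) \<in> borel_measurable M"
    by (rule measurable_compose) (intro borel_measurable_continuous_onI continuous_intros)
  then have "(\<lambda>\<omega>. f (fst (?s \<omega>))) \<in> borel_measurable M"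
    by (rule measurable_compose)
      (intro borel_measurable_continuous_onI continuous_on_smooth[OF smooth])
  \<comment> \<open>The gap is nonnegative and measurable, so the bound on its extended expectation yields integrability.\<close>
  then have meas: "(\<lambda>\<omega>. c * gap k \<omega>) \<in> borel_measurable M"
    by (simp add: gap_def)
  have nonneg: "0 \<le> c * gap k \<omega>" for \<omega>
    using c min by (simp add: gap_def)
  have "(\<integral>\<^sup>+\<omega>. ennreal (c * gap k \<omega>) \<partial>M) \<le> (\<integral>\<^sup>+\<omega>. potential f h xstar k (?s \<omega>) \<partial>M)"
    by (intro nn_integral_mono ennreal_leI) (simp add: potential_def gap_def c_def mult_ac)
  also note expected_potential_le[OF cvx smooth min Lh rate x0_sq]
  finally have bound: "(\<integral>\<^sup>+\<omega>. ennreal (c * gap k \<omega>) \<partial>M)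
      \<le> ennreal (16 * (\<integral>\<omega>. (norm (x0 \<omega> - xstar))\<^sup>2 \<partial>M))" .
  have int: "integrable M (\<lambda>\<omega>. c * gap k \<omega>)"
    using meas nonneg bound
    by (intro integrableI_bounded) (auto simp: less_top[symmetric] top_unique)
  then show "integrable M (gap k)"
    using c by simp
  have "(\<integral>\<omega>. c * gap k \<omega> \<partial>M) \<le> 16 * (\<integral>\<omega>. (norm (x0 \<omega> - xstar))\<^sup>2 \<partial>M)"
    using bound nonneg int by (simp add: nn_integral_eq_integral)
  then show "(2 * real k + 1) * (real k + 11) * h\<^sup>2 * (\<integral>\<omega>. gap k \<omega> \<partial>M)
       \<le> 16 * (\<integral>\<omega>. (norm (x0 \<omega> - xstar))\<^sup>2 \<partial>M)"
    by (simp add: c_def)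
qed

end

section \<open>Number of iterations\<close>

theorem corollary2:
  fixes f :: "real ^ 'd \<Rightarrow> real"
    and L \<epsilon> h :: real
    and \<gamma> :: "nat \<Rightarrow> real"
    and xstar :: "real ^ 'd"
    and M :: "'w measure"
    and x0 :: "'w \<Rightarrow> real ^ 'd"
    and refresh :: "nat \<Rightarrow> 'w set"
    and K :: nat
  assumes "L \<ge> 1"
    and "weakly_convex f"
    and "smooth L f"
    and "\<forall>x. f xstar \<le> f x"
    and "\<epsilon> > 0"
    and "h = 1 / (7 * sqrt L)"
    and "\<forall>k. \<gamma> k = 17 / (2 * (real k + 9) * h)"
    and "rhgd_randomness M x0 h \<gamma> refresh"
    and "integrable M (\<lambda>\<omega>. (norm (x0 \<omega> - xstar))\<^sup>2)"
    and "real K \<ge> sqrt (686 * L * (\<integral>\<omega>. (norm (x0 \<omega> - xstar))\<^sup>2 \<partial>M) / \<epsilon>)"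
  shows "integrable M (\<lambda>\<omega>. f (fst (rhgd f h (\<lambda>k. \<omega> \<in> refresh k) (x0 \<omega>) K)) - f xstar) \<and>
         (\<integral>\<omega>. f (fst (rhgd f h (\<lambda>k. \<omega> \<in> refresh k) (x0 \<omega>) K)) - f xstar \<partial>M) \<le> \<epsilon>"
proof -
  interpret rhgd_randomness M x0 h \<gamma> refresh
    by fact
  define D where "D = (\<integral>\<omega>. (norm (x0 \<omega> - xstar))\<^sup>2 \<partial>M)"
  define G where "G = (\<integral>\<omega>. f (fst (rhgd f h (\<lambda>k. \<omega> \<in> refresh k) (x0 \<omega>) K)) - f xstar \<partial>M)"
  have L: "L > 0" and h: "h > 0"
    using assms(1,6) by auto
  have h2: "h\<^sup>2 = 1 / (49 * L)"
    using L assms(6) by (simp add: power_divide power_mult_distrib)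
  have Lh: "L * h\<^sup>2 \<le> 1 / 11"
    using L by (simp add: h2)
  have rate: "prob (refresh k) = 17 / (2 * (real k + 9))" for k
  proof -
    have "\<gamma> k * h = 17 / (2 * (real k + 9))"
      using h assms(7) by simp
    then show ?thesis
      by (simp add: prob_refresh)
  qed
  have min: "f xstar \<le> f x" for x
    using assms(4) by blast
  note gap = expected_gap_le[OF assms(2,3) min _ Lh rate assms(9), of K]
  have int: "integrable M (\<lambda>\<omega>. f (fst (rhgd f h (\<lambda>k. \<omega> \<in> refresh k) (x0 \<omega>) K)) - f xstar)"
    using gap(1) h by simp
  have "(2 * real K + 1) * (real K + 11) * h\<^sup>2 * G \<le> 16 * D"
    unfolding G_def D_def using gap(2) h by simp
  then have G_le: "(2 * real K + 1) * (real K + 11) * G \<le> 784 * (L * D)"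
    using L by (simp add: h2 field_simps)
  have D: "0 \<le> D"
    by (simp add: D_def)
  have "0 \<le> 686 * L * D / \<epsilon>"
    using L D assms(5) by simp
  moreover have "sqrt (686 * L * D / \<epsilon>) \<le> real K"
    using assms(10) by (simp add: D_def)
  ultimately have "686 * L * D / \<epsilon> \<le> (real K)\<^sup>2"
    using real_sqrt_le_iff real_le_rsqrt sqrt_le_D by blast
  then have "686 * (L * D) \<le> (real K)\<^sup>2 * \<epsilon>"
    using assms(5) by (simp add: field_simps)
  moreover have "0 \<le> L * D"
    using L D by simp
  \<comment> \<open>The leading term \<open>2 K\<^sup>2\<close> of the product is enough for the bound; its constant term \<open>11\<close> keeps the
    product positive, which covers \<open>K = 0\<close> without a separate case.\<close>
  ultimately have "784 * (L * D) \<le> 2 * ((real K)\<^sup>2 * \<epsilon>)"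
    by linarith
  also have "\<dots> \<le> (2 * real K + 1) * (real K + 11) * \<epsilon>"
    using mult_right_mono[of "2 * (real K)\<^sup>2" "(2 * real K + 1) * (real K + 11)" \<epsilon>] assms(5)
    by (simp add: algebra_simps power2_eq_square)
  finally have "784 * (L * D) \<le> (2 * real K + 1) * (real K + 11) * \<epsilon>" .
  with G_le have "(2 * real K + 1) * (real K + 11) * G \<le> (2 * real K + 1) * (real K + 11) * \<epsilon>"
    by (rule order_trans)
  then have "G \<le> \<epsilon>"
    by (subst (asm) mult_le_cancel_left_pos) (auto intro!: mult_pos_pos)
  with int show ?thesis
    by (simp add: G_def)
qed

end
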